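(* Let $n\ge 2$ and let $\phi_v\in P_n$ be a plumbers' curve. If $\phi_v$ is singular, then there exists a cell $e$ of $P_n$ of codimension one (that is, of dimension $3n-4$) such that $\phi_v\in\bar e$. Further, if $e'$ is a cell of $P_n$ (of any dimension) with $\phi_v\in e'$ and $\phi_v$ is singular, then every $\phi_{v'}\in\overline{e'}$ is singular. Here closures are taken in $P_n$.
   Context: Plumbers' curves. Let $n\ge 2$ and $v=(v_1,\dots,v_{n-1})\in((0,1)^3)^{n-1}$. Write $v_i=(v_i^x,v_i^y,v_i^z)$, and by convention $v_0=(0,0,0)$, $v_n=(1,1,1)$. For $0\le i\le n-1$ define three (possibly degenerate) straight segments, called pipes: $\mathbf x_i$ from $(v_i^x,v_i^y,v_i^z)$ to $(v_{i+1}^x,v_i^y,v_i^z)$; $\mathbf y_i$ from $(v_{i+1}^x,v_i^y,v_i^z)$ to $(v_{i+1}^x,v_{i+1}^y,v_i^z)$; $\mathbf z_i$ from $(v_{i+1}^x,v_{i+1}^y,v_i^z)$ to $(v_{i+1}^x,v_{i+1}^y,v_{i+1}^z)$. The $n$-move plumbers' curve $\phi_v:[0,1]\to[0,1]^3$ is the piecewise linear path traversing the pipes linearly in the order $\mathbf x_0,\mathbf y_0,\mathbf z_0,\mathbf x_1,\dots,\mathbf z_{n-1}$. The space $P_n$ of all $\phi_v$ is identified (and topologized) with $((0,1)^3)^{n-1}$ via $v$. Two pipes of a plumbers' curve are distant if, in this ordered sequence of pipes, they are separated by at least three intervening pipes. The curve $\phi_v$ is singular if the images of some pair of its distant pipes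 intersect. Cells. For $\sigma_x,\sigma_y,\sigma_z$ in the symmetric group $\Sigma_{n-1}$, let $e(\sigma_x,\sigma_y,\sigma_z)\subset P_n$ be the set of $\phi_v$ with $0<v^x_{\sigma_x(1)}<\cdots<v^x_{\sigma_x(n-1)}<1$, $0<v^y_{\sigma_y(1)}<\cdots<v^y_{\sigma_y(n-1)}<1$ and $0<v^z_{\sigma_z(1)}<\cdots<v^z_{\sigma_z(n-1)}<1$. These are the top-dimensional cells, of dimension $3n-3$. They induce a cell structure on $P_n$: a general cell is the nonempty set of $\phi_v$ obtained from such a system by changing some of the inequalities between consecutive coordinates $v^c_{\sigma_c(i)}<v^c_{\sigma_c(i+1)}$ ($c\in\{x,y,z\}$, $1\le i\le n-2$) to equalities; its codimension is the number of inequalities so changed. *)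

theory Defs
  imports "HOL-Analysis.Analysis"
begin

text \<open>
  A plumbers' curve with \<open>n\<close> moves is identified with its tuple of vertices \<open>v\<close>, an extensional
  function on \<open>{1..n-1}\<close> with values in the open unit cube. The space of plumbers' curves thus
  carries the product topology. The coordinates \<open>x, y, z\<close> are the components \<open>1, 2, 3\<close>.
\<close>

definition plumbers_space :: "nat \<Rightarrow> (nat \<Rightarrow> real ^ 3) topology" where
  "plumbers_space n = product_topology (\<lambda>_. top_of_set {p. \<forall>c. 0 < p $ c \<and> p $ c < 1}) {1..n - 1}"

text \<open>The vertices of the curve, including the endpoints \<open>v\<^sub>0 = (0,0,0)\<close> and \<open>v\<^sub>n = (1,1,1)\<close>.\<close>

definition vertex :: "nat \<Rightarrow> (nat \<Rightarrow> real ^ 3) \<Rightarrow> nat \<Rightarrow> real ^ 3" where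
  "vertex n v i = (if i = 0 then 0 else if i = n then 1 else v i)"

definition x_pipe :: "nat \<Rightarrow> (nat \<Rightarrow> real ^ 3) \<Rightarrow> nat \<Rightarrow> (real ^ 3) set" where
  "x_pipe n v i = closed_segment
     (vector [vertex n v i $ 1, vertex n v i $ 2, vertex n v i $ 3])
     (vector [vertex n v (i + 1) $ 1, vertex n v i $ 2, vertex n v i $ 3])"

definition y_pipe :: "nat \<Rightarrow> (nat \<Rightarrow> real ^ 3) \<Rightarrow> nat \<Rightarrow> (real ^ 3) set" where
  "y_pipe n v i = closed_segment
     (vector [vertex n v (i + 1) $ 1, vertex n v i $ 2, vertex n v i $ 3])
     (vector [vertex n v (i + 1) $ 1, vertex n v (i + 1) $ 2, vertex n v i $ 3])"

definition z_pipe :: "nat \<Rightarrow> (nat \<Rightarrow> real ^ 3) \<Rightarrow> nat \<Rightarrow> (real ^ 3) set" where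
  "z_pipe n v i = closed_segment
     (vector [vertex n v (i + 1) $ 1, vertex n v (i + 1) $ 2, vertex n v i $ 3])
     (vector [vertex n v (i + 1) $ 1, vertex n v (i + 1) $ 2, vertex n v (i + 1) $ 3])"

text \<open>
  The image of the \<open>k\<close>-th pipe, \<open>k < 3 * n\<close>, in the order
  \<open>x\<^sub>0, y\<^sub>0, z\<^sub>0, x\<^sub>1, \<dots>\<close> in which the curve traverses them.
\<close>

definition pipe :: "nat \<Rightarrow> (nat \<Rightarrow> real ^ 3) \<Rightarrow> nat \<Rightarrow> (real ^ 3) set" where
  "pipe n v k =
     (if k mod 3 = 0 then x_pipe n v (k div 3)
      else if k mod 3 = 1 then y_pipe n v (k div 3)
      else z_pipe n v (k div 3))"

definition distant :: "nat \<Rightarrow> nat \<Rightarrow> bool" where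
  "distant j k \<longleftrightarrow> 3 \<le> card {min j k<..<max j k}"

definition singular :: "nat \<Rightarrow> (nat \<Rightarrow> real ^ 3) \<Rightarrow> bool" where
  "singular n v \<longleftrightarrow>
     (\<exists>j < 3 * n. \<exists>k < 3 * n. distant j k \<and> pipe n v j \<inter> pipe n v k \<noteq> {})"

text \<open>
  \<open>E c\<close> is the set of positions at which the inequality of the chain for the coordinate \<open>c\<close> is
  changed to an equality. A permutation of \<open>{1..n-1}\<close> fixes \<open>0\<close> and \<open>n\<close>, so the chain starts with
  \<open>0 <\<close> and ends with \<open>< 1\<close>; these two inequalities are never changed, as \<open>E c \<subseteq> {1..n-2}\<close> below.
\<close>

definition cell_of ::
    "nat \<Rightarrow> (3 \<Rightarrow> nat \<Rightarrow> nat) \<Rightarrow> (3 \<Rightarrow> nat set) \<Rightarrow> (nat \<Rightarrow> real ^ 3) set" where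
  "cell_of n \<sigma> E = {v \<in> topspace (plumbers_space n).
     \<forall>c. \<forall>i<n. if i \<in> E c
                then vertex n v (\<sigma> c i) $ c = vertex n v (\<sigma> c (i + 1)) $ c
                else vertex n v (\<sigma> c i) $ c < vertex n v (\<sigma> c (i + 1)) $ c}"

definition is_cell_codim :: "nat \<Rightarrow> nat \<Rightarrow> (nat \<Rightarrow> real ^ 3) set \<Rightarrow> bool" where
  "is_cell_codim n d e \<longleftrightarrow> e \<noteq> {} \<and>
     (\<exists>\<sigma> E. (\<forall>c. \<sigma> c permutes {1..n - 1}) \<and> (\<forall>c. E c \<subseteq> {1..n - 2}) \<and>
        d = (\<Sum>c\<in>UNIV. card (E c)) \<and> e = cell_of n \<sigma> E)"

definition is_cell :: "nat \<Rightarrow> (nat \<Rightarrow> real ^ 3) set \<Rightarrow> bool" where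
  "is_cell n e \<longleftrightarrow> (\<exists>d. is_cell_codim n d e)"

end

theory Submission
  imports Defs
begin

text \<open>
  Number the corners \<open>0, \<dots>, 3 n\<close> of the curve in the order in which it visits them. The
  coordinate \<open>c\<close> of the \<open>k\<close>-th corner is that of the vertex whose index is the number of
  earlier pipes parallel to the \<open>c\<close>-axis (\<open>moves c k\<close>). A pipe is a box, possibly degenerate,
  whose sides are segments between coordinates of vertices. Two boxes meet iff their sides
  meet in each coordinate, and two intervals meet iff certain weak inequalities between their
  endpoints hold. Hence (\<open>pipes_meet_iff\<close>, \<open>real_segments_meet_iff\<close>) whether two pipes meet is
  a positive Boolean combination of weak inequalities between coordinates of vertices.

  A cell fixes the truth value of all these inequalities, and those that hold on the cell persist
  on its closure (\<open>cell_closure_order\<close>). Since only weak inequalities occur, and only positively,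
  singularity passes from any point of a cell to the closure of the cell.

  For the first claim, take distant pipes that meet, and a direction \<open>c\<close> parallel to neither
  of them. Both are constant in the coordinate \<open>c\<close>, and between them the curve moves in
  direction \<open>c\<close> at least once, so meeting forces a tie between the \<open>c\<close>-coordinates of two
  different vertices (\<open>singular_tie\<close>), which have to be interior. Sort the vertices by each
  coordinate; the tie can be found between two neighbours in the \<open>c\<close>-order. So the curve
  satisfies the weak form of the system of a codimension one cell, and it is the limit of
  convex combinations with any point of that cell (\<open>weak_system_in_closure\<close>).
\<close>


section \<open>Pipes as boxes\<close>

text \<open>
  The closed form counts the \<open>i < k\<close> for which pipe \<open>i\<close> is parallel to the \<open>c\<close>-axis; such pipes
  occur once in every three.
\<close>
definition moves :: "3 \<Rightarrow> nat \<Rightarrow> nat" where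
  "moves c k = (if c = 1 then (k + 2) div 3 else if c = 2 then (k + 1) div 3 else k div 3)"

definition corner :: "nat \<Rightarrow> (nat \<Rightarrow> real ^ 3) \<Rightarrow> nat \<Rightarrow> real ^ 3" where
  "corner n v k = (\<chi> c. vertex n v (moves c k) $ c)"

definition direction :: "nat \<Rightarrow> 3" where
  "direction k = (if k mod 3 = 0 then 1 else if k mod 3 = 1 then 2 else 3)"

lemma moves_mono: "j \<le> k \<Longrightarrow> moves c j \<le> moves c k"
  unfolding moves_def by (auto intro!: div_le_mono)

lemma moves_add_3: "moves c (k + 3) = moves c k + 1"
proof -
  have "(k + 3 + 2) div 3 = (k + 2) div 3 + 1" "(k + 3 + 1) div 3 = (k + 1) div 3 + 1"
    by presburger+
  then show ?thesis by (simp add: moves_def)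
qed

lemma moves_le: "k \<le> 3 * n \<Longrightarrow> moves c k \<le> n"
  unfolding moves_def by (auto; presburger)

lemma moves_Suc_eq:
  assumes "c \<noteq> direction k"
  shows "moves c (Suc k) = moves c k"
proof -
  consider "c = 1" | "c = 2" | "c = 3" using exhaust_3[of c] by blast
  then show ?thesis
  proof cases
    case 1
    then have "k mod 3 \<noteq> 0" using assms by (metis direction_def)
    then have "(Suc k + 2) div 3 = (k + 2) div 3" by presburger
    with 1 show ?thesis by (simp only: moves_def simp_thms if_True)
  next
    case 2
    then have "k mod 3 \<noteq> 1" using assms by (metis direction_def zero_neq_one)
    then have "(Suc k + 1) div 3 = (k + 1) div 3" by presburger
    with 2 show ?thesis by (simp add: moves_def)
  next
    case 3
    then have "k mod 3 = 0 \<or> k mod 3 = 1" using assms by (metis direction_def)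
    then have "Suc k div 3 = k div 3" by presburger
    with 3 show ?thesis by (simp add: moves_def)
  qed
qed

lemma pipe_eq_segment: "pipe n v k = closed_segment (corner n v k) (corner n v (Suc k))"
proof -
  define i where "i = k div 3"
  have corner: "corner n v m = vector [vertex n v ((m + 2) div 3) $ 1,
      vertex n v ((m + 1) div 3) $ 2, vertex n v (m div 3) $ 3]" for m
    by (simp add: vec_eq_iff forall_3 corner_def moves_def)
  consider "k = 3 * i" | "k = 3 * i + 1" | "k = 3 * i + 2"
    unfolding i_def by linarith
  then show ?thesis
  proof cases
    case 1
    have "(3 * i + 1) div 3 = i" "(3 * i + 2) div 3 = i" "(3 * i + 3) div 3 = i + 1"
      by simp_all
    with 1 show ?thesis by (simp add: pipe_def x_pipe_def corner)
  next
    case 2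
    have "(3 * i + 1) div 3 = i" "(3 * i + 2) div 3 = i" "(3 * i + 3) div 3 = i + 1"
      "(3 * i + 4) div 3 = i + 1" "(3 * i + 1) mod 3 = 1"
      by presburger+
    with 2 show ?thesis by (simp add: pipe_def y_pipe_def corner)
  next
    case 3
    have "(3 * i + 2) div 3 = i" "(3 * i + 3) div 3 = i + 1"
      "(3 * i + 4) div 3 = i + 1" "(3 * i + 5) div 3 = i + 1" "(3 * i + 2) mod 3 = 2"
      by presburger+
    with 3 show ?thesis by (simp add: pipe_def z_pipe_def corner)
  qed
qed

text \<open>
  The position on the segment is read off from the only coordinate that varies; the others impose
  no condition on it.
\<close>
lemma axis_parallel_segment_iff:
  fixes a b x :: "real ^ 'n"
  assumes "\<And>c. c \<noteq> d \<Longrightarrow> a $ c = b $ c"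
  shows "x \<in> closed_segment a b \<longleftrightarrow> (\<forall>c. x $ c \<in> closed_segment (a $ c) (b $ c))"
proof
  assume "x \<in> closed_segment a b"
  then show "\<forall>c. x $ c \<in> closed_segment (a $ c) (b $ c)"
    by (auto simp: in_segment)
next
  assume x: "\<forall>c. x $ c \<in> closed_segment (a $ c) (b $ c)"
  then obtain t where t: "0 \<le> t" "t \<le> 1" "x $ d = (1 - t) *\<^sub>R a $ d + t *\<^sub>R b $ d"
    by (meson in_segment(1))
  have "x $ c = ((1 - t) *\<^sub>R a + t *\<^sub>R b) $ c" for c
  proof (cases "c = d")
    case False
    then have "x $ c = b $ c" using x assms by (metis closed_segment_idem singletonD)
    with False assms show ?thesis by (simp add: algebra_simps)
  qed (use t in simp)
  then have "x = (1 - t) *\<^sub>R a + t *\<^sub>R b" by (simp add: vec_eq_iff)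
  with t show "x \<in> closed_segment a b" by (auto simp: in_segment)
qed

lemma real_segments_meet_iff:
  fixes a b c d :: real
  shows "closed_segment a b \<inter> closed_segment c d \<noteq> {} \<longleftrightarrow>
    (a \<le> c \<or> a \<le> d \<or> b \<le> c \<or> b \<le> d) \<and> (c \<le> a \<or> c \<le> b \<or> d \<le> a \<or> d \<le> b)"
  by (auto simp: closed_segment_eq_real_ivl Int_atLeastAtMost)

lemma pipe_iff:
  "x \<in> pipe n v k \<longleftrightarrow> (\<forall>c. x $ c \<in> closed_segment
     (vertex n v (moves c k) $ c) (vertex n v (moves c (Suc k)) $ c))"
proof -
  have "corner n v k $ c = corner n v (Suc k) $ c" if "c \<noteq> direction k" for c
    using moves_Suc_eq[OF that] by (simp add: corner_def)
  from axis_parallel_segment_iff[OF this] show ?thesis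
    unfolding pipe_eq_segment by (simp add: corner_def)
qed

text \<open>
  Pipes are boxes, so a common point can be chosen coordinate by coordinate.
\<close>
lemma pipes_meet_iff:
  "pipe n v j \<inter> pipe n v k \<noteq> {} \<longleftrightarrow> (\<forall>c.
     closed_segment (vertex n v (moves c j) $ c) (vertex n v (moves c (Suc j)) $ c) \<inter>
     closed_segment (vertex n v (moves c k) $ c) (vertex n v (moves c (Suc k)) $ c) \<noteq> {})"
    (is "_ \<longleftrightarrow> (\<forall>c. ?I c \<inter> ?J c \<noteq> {})")
proof
  assume "pipe n v j \<inter> pipe n v k \<noteq> {}"
  then obtain x where "x \<in> pipe n v j" "x \<in> pipe n v k" by blast
  then show "\<forall>c. ?I c \<inter> ?J c \<noteq> {}" unfolding pipe_iff by blast
next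
  assume "\<forall>c. ?I c \<inter> ?J c \<noteq> {}"
  then have "\<forall>c. \<exists>r. r \<in> ?I c \<inter> ?J c" by blast
  then obtain r where "\<And>c. r c \<in> ?I c \<inter> ?J c" by metis
  then have "(\<chi> c. r c) \<in> pipe n v j \<inter> pipe n v k" by (simp add: pipe_iff)
  then show "pipe n v j \<inter> pipe n v k \<noteq> {}" by blast
qed


section \<open>Singular curves have two vertices with a common coordinate\<close>

lemma in_plumbers_space_iff:
  "v \<in> topspace (plumbers_space n) \<longleftrightarrow>
     v \<in> extensional {1..n - 1} \<and> (\<forall>i \<in> {1..n - 1}. \<forall>c. 0 < v i $ c \<and> v i $ c < 1)"
  by (auto simp: plumbers_space_def PiE_iff)

lemma vertex_0 [simp]: "vertex n v 0 = 0"
  by (simp add: vertex_def)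

lemma vertex_n [simp]: "0 < n \<Longrightarrow> vertex n v n = 1"
  by (simp add: vertex_def)

lemma vertex_interior: "i \<in> {1..n - 1} \<Longrightarrow> vertex n v i = v i"
  by (auto simp: vertex_def)

lemma vertex_pos:
  "v \<in> topspace (plumbers_space n) \<Longrightarrow> 0 < i \<Longrightarrow> i \<le> n \<Longrightarrow> 0 < vertex n v i $ c"
  by (auto simp: vertex_def in_plumbers_space_iff)

lemma vertex_less_1:
  "v \<in> topspace (plumbers_space n) \<Longrightarrow> i < n \<Longrightarrow> vertex n v i $ c < 1"
  by (auto simp: vertex_def in_plumbers_space_iff)

lemma vertices_tie_interior:
  assumes "v \<in> topspace (plumbers_space n)" "a < b" "b \<le> n"
    and "vertex n v a $ c = vertex n v b $ c"
  shows "a \<in> {1..n - 1}" "b \<in> {1..n - 1}"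
proof -
  have "a \<noteq> 0" using assms vertex_pos[of v n b c] by (metis gr_zeroI less_irrefl vertex_0 zero_index less_zeroE)
  moreover have "b \<noteq> n" using assms vertex_less_1[of v n a c] by auto
  ultimately show "a \<in> {1..n - 1}" "b \<in> {1..n - 1}" using assms(2,3) by auto
qed

lemma distant_iff: "distant j k \<longleftrightarrow> j + 4 \<le> k \<or> k + 4 \<le> j"
  by (auto simp: distant_def min_def max_def)

text \<open>
  Of the three directions, one is parallel to neither of the two pipes. Any three consecutive
  pipes include one in this direction, so the two pipes have different vertex indices there.
\<close>
lemma singular_tie:
  assumes "v \<in> topspace (plumbers_space n)" "singular n v"
  obtains c a b where "a < b" "a \<in> {1..n - 1}" "b \<in> {1..n - 1}" "v a $ c = v b $ c"
proof -
  obtain j k where jk: "j + 4 \<le> k" "k < 3 * n" "pipe n v j \<inter> pipe n v k \<noteq> {}"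
    using assms(2) unfolding singular_def distant_iff by (metis inf_commute)
  have "\<exists>c. c \<noteq> direction j \<and> c \<noteq> direction k"
  proof -
    have "(1 :: 3) \<noteq> 2" "(1 :: 3) \<noteq> 3" "(2 :: 3) \<noteq> 3" by simp_all
    then show ?thesis by metis
  qed
  then obtain c where c: "c \<noteq> direction j" "c \<noteq> direction k" by blast
  define a b where "a = moves c j" and "b = moves c k"
  have "moves c (j + 3) \<le> b" unfolding b_def using jk(1) by (intro moves_mono) simp
  then have ab: "a < b" unfolding a_def moves_add_3 by simp
  have bn: "b \<le> n" unfolding b_def using jk(2) by (intro moves_le) simp
  have "closed_segment (vertex n v a $ c) (vertex n v a $ c) \<inter>
        closed_segment (vertex n v b $ c) (vertex n v b $ c) \<noteq> {}"
    using jk(3) unfolding pipes_meet_iff a_def b_def by (metis moves_Suc_eq c)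
  then have eq: "vertex n v a $ c = vertex n v b $ c" by auto
  note int = vertices_tie_interior[OF assms(1) ab bn eq]
  with eq have "v a $ c = v b $ c" by (simp add: vertex_interior)
  with ab int that show ?thesis by blast
qed


section \<open>Cells determine the order of the coordinates\<close>

lemma cell_of_eq:
  assumes "v \<in> cell_of n \<sigma> E" "i < n" "i \<in> E c"
  shows "vertex n v (\<sigma> c i) $ c = vertex n v (\<sigma> c (i + 1)) $ c"
  using assms unfolding cell_of_def mem_Collect_eq by meson

lemma cell_of_less:
  assumes "v \<in> cell_of n \<sigma> E" "i < n" "i \<notin> E c"
  shows "vertex n v (\<sigma> c i) $ c < vertex n v (\<sigma> c (i + 1)) $ c"
  using assms unfolding cell_of_def mem_Collect_eq by meson

text \<open>
  If \<open>a\<close> comes after \<open>b\<close> in the chain of \<open>c\<close> and yet \<open>v\<^sub>a \<le> v\<^sub>b\<close>, then all links of the chain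
  between them are equalities, and these hold throughout the cell.
\<close>
lemma cell_order:
  assumes v: "v \<in> cell_of n \<sigma> E" and w: "w \<in> cell_of n \<sigma> E"
    and \<sigma>: "\<sigma> c permutes {1..n - 1}" and "a \<le> n" "b \<le> n"
    and le: "vertex n v a $ c \<le> vertex n v b $ c"
  shows "vertex n w a $ c \<le> vertex n w b $ c"
proof -
  have mono: "vertex n u (\<sigma> c i) $ c \<le> vertex n u (\<sigma> c j) $ c"
    if "u \<in> cell_of n \<sigma> E" "i \<le> j" "j \<le> n" for u i j
    using that(2,3)
  proof (induction rule: dec_induct)
    case (step l)
    have "vertex n u (\<sigma> c l) $ c \<le> vertex n u (\<sigma> c (l + 1)) $ c"
      using cell_of_eq[OF that(1), of l c] cell_of_less[OF that(1), of l c] step.prems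
      by (cases "l \<in> E c") auto
    with step show ?case by simp
  qed simp
  have "\<sigma> c permutes {0..n}" by (rule permutes_subset[OF \<sigma>]) auto
  then have img: "\<sigma> c ` {0..n} = {0..n}" by (rule permutes_image)
  have "a \<in> \<sigma> c ` {0..n}" "b \<in> \<sigma> c ` {0..n}" using \<open>a \<le> n\<close> \<open>b \<le> n\<close> unfolding img by auto
  then obtain i j where i: "i \<le> n" "a = \<sigma> c i" and j: "j \<le> n" "b = \<sigma> c j" by auto
  show ?thesis
  proof (cases "i \<le> j")
    case True
    then show ?thesis using mono[OF w] i j by simp
  next
    case False
    have E: "l \<in> E c" if "j \<le> l" "l < i" for l
    proof (rule ccontr)
      assume "l \<notin> E c"
      then have "vertex n v (\<sigma> c l) $ c < vertex n v (\<sigma> c (l + 1)) $ c"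
        using cell_of_less[OF v] that i by simp
      moreover have "vertex n v b $ c \<le> vertex n v (\<sigma> c l) $ c"
        using mono[OF v] that i j by simp
      moreover have "vertex n v (\<sigma> c (l + 1)) $ c \<le> vertex n v a $ c"
        using mono[OF v, of "l + 1" i] that i by simp
      ultimately show False using le by linarith
    qed
    have "vertex n w (\<sigma> c i) $ c = vertex n w (\<sigma> c j) $ c"
    proof -
      have "j \<le> i" using False by simp
      then show ?thesis
        using E i(1)
      proof (induction rule: dec_induct)
        case (step l)
        have "l \<in> E c" using step.hyps step.prems by simp
        then have "vertex n w (\<sigma> c l) $ c = vertex n w (\<sigma> c (Suc l)) $ c"
          using cell_of_eq[OF w, of l c] step.prems by simp
        then show ?case using step by simp
      qed simp
    qed
    then show ?thesis using i j by simp
  qed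
qed

lemma continuous_map_vertex_component:
  assumes "a \<le> n"
  shows "continuous_map (plumbers_space n) euclideanreal (\<lambda>w. vertex n w a $ c)"
proof (cases "a \<in> {1..n - 1}")
  case True
  have "continuous_map (plumbers_space n) (top_of_set {p. \<forall>c. 0 < p $ c \<and> p $ c < 1})
      (\<lambda>w. w a)"
    unfolding plumbers_space_def by (rule continuous_map_product_projection[OF True])
  then have "continuous_map (plumbers_space n) euclidean (\<lambda>w. w a :: real ^ 3)"
    by (rule continuous_map_into_fulltopology)
  moreover have "continuous_map euclidean euclideanreal (\<lambda>p :: real ^ 3. p $ c)"
    by (intro continuous_map_iff_continuous2[THEN iffD2] continuous_intros)
  ultimately have "continuous_map (plumbers_space n) euclideanreal ((\<lambda>p. p $ c) \<circ> (\<lambda>w. w a))"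
    by (rule continuous_map_compose)
  then show ?thesis by (simp add: o_def vertex_interior[OF True])
next
  case False
  then have "a = 0 \<or> a = n" using assms by auto
  then show ?thesis by (cases "n = 0") (auto simp: vertex_def)
qed

text \<open>
  A weak inequality between continuous functions passes to the closure. A strict one would not,
  which is why singular curves must be described by weak inequalities alone.
\<close>
lemma cell_closure_order:
  assumes v: "v \<in> cell_of n \<sigma> E" and w: "w \<in> plumbers_space n closure_of cell_of n \<sigma> E"
    and \<sigma>: "\<sigma> c permutes {1..n - 1}" and ab: "a \<le> n" "b \<le> n"
    and le: "vertex n v a $ c \<le> vertex n v b $ c"
  shows "vertex n w a $ c \<le> vertex n w b $ c"
proof -
  let ?f = "\<lambda>w. vertex n w b $ c - vertex n w a $ c"
  let ?S = "{u \<in> topspace (plumbers_space n). ?f u \<in> {0..}}"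
  have "closedin (plumbers_space n) ?S"
    by (rule closedin_continuous_map_preimage[of _ euclideanreal])
      (auto intro!: continuous_map_diff continuous_map_vertex_component ab)
  moreover have "cell_of n \<sigma> E \<subseteq> ?S"
    using cell_order[OF v _ \<sigma> ab le] by (auto simp: cell_of_def)
  ultimately have "plumbers_space n closure_of cell_of n \<sigma> E \<subseteq> ?S"
    by (intro closure_of_minimal)
  with w show ?thesis by auto
qed

lemma singular_closure_cell:
  assumes v: "v \<in> cell_of n \<sigma> E" and w: "w \<in> plumbers_space n closure_of cell_of n \<sigma> E"
    and \<sigma>: "\<And>c. \<sigma> c permutes {1..n - 1}" and "singular n v"
  shows "singular n w"
proof -
  obtain j k where jk: "j < 3 * n" "k < 3 * n" "distant j k" "pipe n v j \<inter> pipe n v k \<noteq> {}"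
    using \<open>singular n v\<close> unfolding singular_def by blast
  have order: "vertex n w a $ c \<le> vertex n w b $ c"
    if "vertex n v a $ c \<le> vertex n v b $ c" "a \<le> n" "b \<le> n" for a b c
    using cell_closure_order[OF v w \<sigma> that(2,3,1)] .
  have le: "moves c j \<le> n" "moves c (Suc j) \<le> n" "moves c k \<le> n" "moves c (Suc k) \<le> n" for c
    using jk(1,2) by (auto intro!: moves_le)
  have "pipe n w j \<inter> pipe n w k \<noteq> {}"
    unfolding pipes_meet_iff
  proof
    fix c
    show "closed_segment (vertex n w (moves c j) $ c) (vertex n w (moves c (Suc j)) $ c) \<inter>
        closed_segment (vertex n w (moves c k) $ c) (vertex n w (moves c (Suc k)) $ c) \<noteq> {}"
      using jk(4)[unfolded pipes_meet_iff real_segments_meet_iff, THEN spec[of _ c]]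
        le[of c] order[where c = c]
      unfolding real_segments_meet_iff by blast
  qed
  with jk(1-3) show ?thesis unfolding singular_def by blast
qed


section \<open>Points in the closure of a cell\<close>

text \<open>
  The coordinate at position \<open>i\<close> of a chain is the number of strict inequalities before \<open>i\<close>, scaled
  to go from \<open>0\<close> to \<open>1\<close>.
\<close>
lemma cell_of_nonempty:
  assumes n: "0 < n" and \<sigma>: "\<And>c. \<sigma> c permutes {1..n - 1}" and E: "\<And>c. E c \<subseteq> {1..n - 2}"
  shows "cell_of n \<sigma> E \<noteq> {}"
proof -
  define h where "h c i = card ({..<i} - E c)" for c i
  define g where "g c i = real (h c i) / real (h c n)" for c i
  define u where "u = (\<lambda>i \<in> {1..n - 1}. \<chi> c. g c (inv (\<sigma> c) i))"
  have h_0: "h c 0 = 0" for c by (simp add: h_def)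
  have h_Suc: "h c (Suc i) = (if i \<in> E c then h c i else Suc (h c i))" for c i
    by (simp add: h_def lessThan_Suc insert_Diff_if)
  have h_mono: "i \<le> j \<Longrightarrow> h c i \<le> h c j" for c i j
    unfolding h_def by (intro card_mono) auto
  \<comment> \<open>The first and the last inequality of a chain are strict.\<close>
  have "0 \<notin> E c" "n - 1 \<notin> E c" for c using subsetD[OF E[of c]] n by force+
  then have h_1: "h c 1 = 1" and h_n: "h c n = Suc (h c (n - 1))" for c
    using h_Suc[of c 0] h_0[of c] h_Suc[of c "n - 1"] n by auto
  have hn: "0 < h c n" for c by (simp add: h_n)
  have g_bounds: "0 < g c i \<and> g c i < 1" if "i \<in> {1..n - 1}" for c i
  proof -
    have "1 \<le> h c i" "h c i \<le> h c (n - 1)"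
      using h_mono[of 1 i c] h_mono[of i "n - 1" c] that unfolding h_1 by auto
    then show ?thesis unfolding g_def using h_n[of c] by simp
  qed
  have inv_in: "inv (\<sigma> c) i \<in> {1..n - 1} \<longleftrightarrow> i \<in> {1..n - 1}" for c i
    using permutes_in_image[OF permutes_inv[OF \<sigma>]] .
  have u: "u \<in> topspace (plumbers_space n)"
    unfolding in_plumbers_space_iff u_def using g_bounds inv_in by auto
  have vertex_u: "vertex n u (\<sigma> c i) $ c = g c i" if "i \<le> n" for c i
  proof -
    consider "i = 0" | "i = n" | "i \<in> {1..n - 1}" using \<open>i \<le> n\<close> by fastforce
    then show ?thesis
    proof cases
      case 1
      then have "\<sigma> c i = 0" using \<sigma>[of c] by (auto simp: permutes_def)
      with 1 show ?thesis by (simp add: g_def h_0)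
    next
      case 2
      then have "\<sigma> c i = n" using \<sigma>[of c] n by (auto simp: permutes_def)
      with 2 n hn[of c] show ?thesis by (simp add: g_def)
    next
      case 3
      then have "\<sigma> c i \<in> {1..n - 1}" using permutes_in_image[OF \<sigma>] by blast
      then show ?thesis
        by (simp add: vertex_interior u_def permutes_inverses(2)[OF \<sigma>])
    qed
  qed
  have "u \<in> cell_of n \<sigma> E"
    using u hn by (auto simp: cell_of_def vertex_u g_def h_Suc divide_strict_right_mono)
  then show ?thesis by blast
qed

text \<open>
  A convex combination of a weak and a strict inequality is strict if the strict one has positive
  weight. So the segment from a point of the cell to \<open>v\<close> stays in the cell until it reaches \<open>v\<close>.
\<close>
lemma weak_system_in_closure:
  assumes u: "u \<in> cell_of n \<sigma> E" and v: "v \<in> topspace (plumbers_space n)"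
    and \<sigma>: "\<And>c. \<sigma> c permutes {1..n - 1}"
    and weak: "\<And>c i. i < n \<Longrightarrow> vertex n v (\<sigma> c i) $ c \<le> vertex n v (\<sigma> c (i + 1)) $ c"
    and eq: "\<And>c i. i < n \<Longrightarrow> i \<in> E c \<Longrightarrow>
      vertex n v (\<sigma> c i) $ c = vertex n v (\<sigma> c (i + 1)) $ c"
  shows "v \<in> plumbers_space n closure_of cell_of n \<sigma> E"
proof -
  define t :: "nat \<Rightarrow> real" where "t k = inverse (real (Suc k))" for k
  define w where "w k = (\<lambda>i \<in> {1..n - 1}. (1 - t k) *\<^sub>R v i + t k *\<^sub>R u i)" for k
  have t: "0 < t k" "t k \<le> 1" for k by (auto simp: t_def field_simps)
  have uT: "u \<in> topspace (plumbers_space n)" using u by (simp add: cell_of_def)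
  have wT: "w k \<in> topspace (plumbers_space n)" for k
  proof -
    have "(1 - t k) * r + t k * s \<in> {0<..<1}" if "r \<in> {0<..<1}" "s \<in> {0<..<1}" for r s
      using convexD[OF convex_real_interval(8)[of 0 1] that, of "1 - t k" "t k"] t[of k] by simp
    then show ?thesis
      using v uT unfolding in_plumbers_space_iff by (simp add: w_def)
  qed
  have vertex_w: "vertex n (w k) i $ c = (1 - t k) * vertex n v i $ c + t k * vertex n u i $ c"
    if "i \<le> n" for k i c
    using that by (auto simp: vertex_def w_def)
  have \<sigma>_le: "\<sigma> c i \<le> n" if "i \<le> n" for c i
    using permutes_in_image[OF permutes_subset[OF \<sigma>[of c], of "{0..n}"], of i] that by auto
  have "w k \<in> cell_of n \<sigma> E" for k
  proof -
    have "if i \<in> E c then vertex n (w k) (\<sigma> c i) $ c = vertex n (w k) (\<sigma> c (i + 1)) $ c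
          else vertex n (w k) (\<sigma> c i) $ c < vertex n (w k) (\<sigma> c (i + 1)) $ c"
      if i: "i < n" for c i
    proof (cases "i \<in> E c")
      case True
      then have "vertex n u (\<sigma> c i) $ c = vertex n u (\<sigma> c (i + 1)) $ c"
        using cell_of_eq[OF u i] by simp
      with True i eq[OF i True] show ?thesis by (simp add: vertex_w \<sigma>_le)
    next
      case False
      then have "vertex n u (\<sigma> c i) $ c < vertex n u (\<sigma> c (i + 1)) $ c"
        using cell_of_less[OF u i] by simp
      then have "(1 - t k) * vertex n v (\<sigma> c i) $ c + t k * vertex n u (\<sigma> c i) $ c
          < (1 - t k) * vertex n v (\<sigma> c (i + 1)) $ c + t k * vertex n u (\<sigma> c (i + 1)) $ c"
        using weak[OF i] t[of k] by (intro add_le_less_mono mult_left_mono) auto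
      with False i show ?thesis by (simp add: vertex_w \<sigma>_le)
    qed
    with wT show ?thesis unfolding cell_of_def by blast
  qed
  moreover have "cell_of n \<sigma> E \<subseteq> topspace (plumbers_space n)" by (auto simp: cell_of_def)
  ultimately have wC: "w k \<in> plumbers_space n closure_of cell_of n \<sigma> E" for k
    using closure_of_subset by blast
  have "limitin (plumbers_space n) w v sequentially"
  proof -
    have "(\<lambda>k. w k i) \<longlonglongrightarrow> v i" if "i \<in> {1..n - 1}" for i
    proof -
      have "t \<longlonglongrightarrow> 0" unfolding t_def by (rule LIMSEQ_inverse_real_of_nat)
      then have "(\<lambda>k. (1 - t k) *\<^sub>R v i + t k *\<^sub>R u i) \<longlonglongrightarrow> (1 - 0) *\<^sub>R v i + 0 *\<^sub>R u i"
        by (intro tendsto_intros)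
      with that show ?thesis by (simp add: w_def)
    qed
    moreover have "\<forall>c. 0 < w k i $ c \<and> w k i $ c < 1" if "i \<in> {1..n - 1}" for k i
      using wT[of k] that by (auto simp: in_plumbers_space_iff)
    ultimately show ?thesis
      using v wT unfolding in_plumbers_space_iff
      by (auto simp: plumbers_space_def limitin_componentwise limitin_subtopology PiE_iff)
  qed
  then show ?thesis
    by (rule limitin_closedin[OF _ closedin_closure_of]) (auto simp: wC)
qed

lemma sorting_permutation:
  fixes f :: "nat \<Rightarrow> 'a :: linorder"
  obtains p where "p permutes {1..m}"
    and "\<And>i j. 1 \<le> i \<Longrightarrow> i \<le> j \<Longrightarrow> j \<le> m \<Longrightarrow> f (p i) \<le> f (p j)"
proof -
  define xs where "xs = sort_key f [1..<Suc m]"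
  define p where "p i = (if i \<in> {1..m} then xs ! (i - 1) else i)" for i
  have xs: "set xs = {1..m}" "distinct xs" "length xs = m" "sorted (map f xs)"
    by (auto simp: xs_def)
  have "bij_betw (\<lambda>i. xs ! (i - 1)) {1..m} {1..m}"
  proof -
    have "bij_betw (\<lambda>i. i - 1) {1..m} {..<m}"
      by (rule bij_betwI[where g = Suc]) auto
    moreover have "bij_betw ((!) xs) {..<m} {1..m}"
      using xs by (intro bij_betw_nth) auto
    ultimately show ?thesis by (rule bij_betw_trans[unfolded o_def])
  qed
  then have "bij_betw p {1..m} {1..m}" by (rule bij_betw_cong[THEN iffD1, rotated]) (simp add: p_def)
  then have "p permutes {1..m}" by (rule bij_imp_permutes) (auto simp: p_def)
  moreover have "f (p i) \<le> f (p j)" if "1 \<le> i" "i \<le> j" "j \<le> m" for i j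
    using sorted_nth_mono[OF xs(4), of "i - 1" "j - 1"] that xs(3) by (simp add: p_def)
  ultimately show ?thesis using that by blast
qed

lemma tie_in_closure_codim_1:
  assumes v: "v \<in> topspace (plumbers_space n)"
    and ab: "a \<noteq> b" "a \<in> {1..n - 1}" "b \<in> {1..n - 1}" and tie: "v a $ c = v b $ c"
  shows "\<exists>e. is_cell_codim n 1 e \<and> v \<in> plumbers_space n closure_of e"
proof -
  have n: "0 < n" using ab by auto
  have "\<exists>p. p permutes {1..n - 1} \<and>
      (\<forall>i j. 1 \<le> i \<longrightarrow> i \<le> j \<longrightarrow> j \<le> n - 1 \<longrightarrow> v (p i) $ d \<le> v (p j) $ d)" for d
    using sorting_permutation[of "n - 1" "\<lambda>i. v i $ d"] by metis
  then obtain \<sigma> where \<sigma>: "\<And>d. \<sigma> d permutes {1..n - 1}"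
    and sorted: "\<And>d i j. 1 \<le> i \<Longrightarrow> i \<le> j \<Longrightarrow> j \<le> n - 1 \<Longrightarrow> v (\<sigma> d i) $ d \<le> v (\<sigma> d j) $ d"
    by metis
  have in_iff: "\<sigma> d i \<in> {1..n - 1} \<longleftrightarrow> i \<in> {1..n - 1}" for d i
    by (rule permutes_in_image[OF \<sigma>])
  \<comment> \<open>All values between the tied positions coincide, so the earlier one is tied with its successor.\<close>
  obtain l where l: "1 \<le> l" "l \<le> n - 2" "v (\<sigma> c l) $ c = v (\<sigma> c (l + 1)) $ c"
  proof -
    have "a \<in> \<sigma> c ` {1..n - 1}" "b \<in> \<sigma> c ` {1..n - 1}"
      using ab permutes_image[OF \<sigma>[of c]] by auto
    then obtain i j where ij: "i \<in> {1..n - 1}" "j \<in> {1..n - 1}" "\<sigma> c i = a" "\<sigma> c j = b"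
      by blast
    then have "\<exists>i j. i < j \<and> 1 \<le> i \<and> j \<le> n - 1 \<and> v (\<sigma> c i) $ c = v (\<sigma> c j) $ c"
      using tie ab(1) by (metis atLeastAtMost_iff linorder_neqE_nat)
    then obtain i j where "i < j" "1 \<le> i" "j \<le> n - 1" "v (\<sigma> c i) $ c = v (\<sigma> c j) $ c"
      by blast
    then have "v (\<sigma> c i) $ c = v (\<sigma> c (i + 1)) $ c"
      using sorted[of i "i + 1" c] sorted[of "i + 1" j c] by simp
    with \<open>i < j\<close> \<open>1 \<le> i\<close> \<open>j \<le> n - 1\<close> that show ?thesis by auto
  qed
  define E where "E d = (if d = c then {l} else {})" for d
  have E: "E d \<subseteq> {1..n - 2}" for d using l by (auto simp: E_def)
  have "(\<Sum>d\<in>UNIV. card (E d)) = (\<Sum>d\<in>UNIV. if d = c then 1 else 0)"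
    by (intro sum.cong) (auto simp: E_def)
  then have card: "(\<Sum>d\<in>UNIV. card (E d)) = 1" by simp
  obtain u where u: "u \<in> cell_of n \<sigma> E" using cell_of_nonempty[of n \<sigma> E] n \<sigma> E by blast
  have weak: "vertex n v (\<sigma> d i) $ d \<le> vertex n v (\<sigma> d (i + 1)) $ d" if "i < n" for d i
  proof -
    consider "i = 0" | "i + 1 = n" | "i \<in> {1..n - 1}" "i + 1 \<in> {1..n - 1}"
      using \<open>i < n\<close> by fastforce
    then show ?thesis
    proof cases
      case 1
      then have "\<sigma> d i = 0" using \<sigma>[of d] by (auto simp: permutes_def)
      moreover have "\<sigma> d (i + 1) \<in> {1..n}"
        using permutes_in_image[OF permutes_subset[OF \<sigma>[of d], of "{1..n}"], of "i + 1"] 1 n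
        by auto
      ultimately show ?thesis using vertex_pos[OF v, of "\<sigma> d (i + 1)" d] by simp
    next
      case 2
      then have "\<sigma> d (i + 1) = n" using \<sigma>[of d] n by (auto simp: permutes_def)
      moreover have "{1..n - 1} \<subseteq> {..<n}" using n by auto
      then have "\<sigma> d i < n"
        using permutes_in_image[OF permutes_subset[OF \<sigma>[of d]], of "{..<n}" i] \<open>i < n\<close>
        by simp
      ultimately show ?thesis using vertex_less_1[OF v, of "\<sigma> d i" d] n by simp
    next
      case 3
      then show ?thesis
        using sorted[of i "i + 1" d] in_iff[of d i] in_iff[of d "i + 1"]
        by (simp add: vertex_interior)
    qed
  qed
  have eq: "vertex n v (\<sigma> d i) $ d = vertex n v (\<sigma> d (i + 1)) $ d" if "i \<in> E d" for d i
  proof -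
    have "d = c" "i = l" using that by (auto simp: E_def split: if_splits)
    then show ?thesis
      using l in_iff[of c l] in_iff[of c "l + 1"] by (simp add: vertex_interior)
  qed
  have "v \<in> plumbers_space n closure_of cell_of n \<sigma> E"
    using weak_system_in_closure[OF u v \<sigma> weak eq] by blast
  moreover have "is_cell_codim n 1 (cell_of n \<sigma> E)"
    unfolding is_cell_codim_def using u \<sigma> E card by (metis empty_iff)
  ultimately show ?thesis by blast
qed

theorem lemma2p4:
  fixes n :: nat and v :: "nat \<Rightarrow> real ^ 3"
  assumes "n \<ge> 2"
    and "v \<in> topspace (plumbers_space n)"
    and "singular n v"
  shows "(\<exists>e. is_cell_codim n 1 e \<and> v \<in> plumbers_space n closure_of e) \<and>
    (\<forall>e'. is_cell n e' \<and> v \<in> e' \<longrightarrow>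
       (\<forall>v' \<in> plumbers_space n closure_of e'. singular n v'))"
proof (intro conjI allI impI ballI)
  show "\<exists>e. is_cell_codim n 1 e \<and> v \<in> plumbers_space n closure_of e"
    using singular_tie[OF assms(2,3)] tie_in_closure_codim_1[OF assms(2)]
    by (metis less_irrefl_nat)
next
  fix e' v'
  assume e': "is_cell n e' \<and> v \<in> e'" and v': "v' \<in> plumbers_space n closure_of e'"
  then obtain \<sigma> E where "\<And>c. \<sigma> c permutes {1..n - 1}" "e' = cell_of n \<sigma> E"
    unfolding is_cell_def is_cell_codim_def by blast
  with e' v' show "singular n v'"
    using singular_closure_cell[of v n \<sigma> E v'] assms(3) by blast
qed

end
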